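(* Each of the four interpolating inference rules Hyp-A, Hyp-B, Comb and Strengthen defined below preserves validity of annotated sequents: whenever all premises of an instance of one of these rules are valid annotated sequents (a rule without premises has none), the conclusion of that instance is a valid annotated sequent. The rules (for fixed conjunctions $A$, $B$ of $\mathcal{LA}(\mathbb{Z})$ equalities and inequalities) are: (1) Hyp-A: derive $(A,B)\vdash (t\le 0)\,[\{\langle t\le 0,\top\rangle\}]$, provided $(t\le 0)$ or $(t=0)$ is a conjunct of $A$. (2) Hyp-B: derive $(A,B)\vdash (t\le 0)\,[\{\langle 0\le 0,\top\rangle\}]$, provided $(t\le 0)$ or $(t=0)$ is a conjunct of $B$. (3) Comb: from $(A,B)\vdash (t_1\le 0)[I_1]$ and $(A,B)\vdash (t_2\le 0)[I_2]$ derive $(A,B)\vdash (c_1t_1+c_2t_2\le 0)[I]$, where $c_1,c_2>0$ and $I=\{\langle c_1t_1'+c_2t_2'\le 0,\ E_1\wedge E_2\rangle \mid \langle t_1'\le 0,E_1\rangle\in I_1,\ \langle t_2'\le 0,E_2\rangle\in I_2\}$. (4) Strengthen: from $(A,B)\vdash (\sum_i c_ix_i+c\le 0)\,[\{\langle t'\le 0,\top\rangle\}]$ derive $(A,B)\vdash (\sum_i c_ix_i+c+k\le 0)\,[I]$, where $d>0$ is an integer dividing all the $c_i$, $k= d\lceil c/d\rceil - c$, and $I=\{\langle t'+j\le 0,\ \exists(x\notin B).(t'+j=0)\rangle \mid 0\le j<k\}\cup\{\langle t'+k\le 0,\top\rangle\}$; here $\exists(x\notin B).(t'+j=0)$ denotes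 the result of existentially eliminating from the equation $t'+j=0$ all and only the variables not occurring in $B$, i.e. $\exists x_1,\dots,x_n.(\sum_i e_ix_i+\sum_j f_jy_j+e=0)$ is replaced by the modular equation $\sum_j f_jy_j+e=_{\gcd(e_i)}0$.
   Context: $\mathcal{LA}(\mathbb{Z})$ is linear arithmetic over the integers: all variables range over $\mathbb{Z}$, terms are linear combinations of variables with integer coefficients plus an integer constant, and $\models$ denotes entailment over integer assignments. A modular equation $t=_g 0$ (for an integer $g\ge 0$) means $g$ divides $t$; $t=_0 0$ means $t=0$. For a term or formula $\phi$ and a formula $\psi$, $\phi\preceq\psi$ means every variable occurring in $\phi$ occurs in $\psi$. An annotated sequent has the form $(A,B)\vdash (t\le 0)\,[I]$ where $A,B$ are conjunctions of $\mathcal{LA}(\mathbb{Z})$ equalities and inequalities, $t$ is a linear term, and $I$ (the annotation) is a set of pairs $\langle t_i\le 0, E_i\rangle$ with $t_i$ a linear term and $E_i$ a (possibly empty, i.e. $\top$) conjunction of equalities and modular equalities. It is valid when: (1) $A\models \bigvee_{\langle t_i\le 0,E_i\rangle\in I}((t_i\le 0)\wedge E_i)$; (2) for every $\langle t_i\le 0,E_i\rangle\in I$, $B\wedge E_i\models (t-t_i\le 0)$; (3) for every $\langle t_i\le 0,E_i\rangle\in I$, $t_i\preceq A$, $(t-t_i)\preceq B$, $E_i\preceq A$ and $E_i\preceq B$. *)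

theory Defs
  imports Complex_Main "HOL-Library.Poly_Mapping" "HOL-Library.Product_Plus"
begin

text \<open>
  A linear term is a pair of a finitely supported coefficient function and an integer constant.
  This is a normal form, so a variable occurs in a term iff its coefficient is nonzero; in
  particular variables that cancel in \<open>t - t'\<close> do not occur there. Addition and subtraction of
  terms are the componentwise operations on pairs.
\<close>

type_synonym 'v lterm = "('v \<Rightarrow>\<^sub>0 int) \<times> int"

definition const_term :: "int \<Rightarrow> 'v lterm" where
  "const_term c = (0, c)"

definition scale_term :: "int \<Rightarrow> 'v lterm \<Rightarrow> 'v lterm" where
  "scale_term c t = (frag_cmul c (fst t), c * snd t)"

definition term_vars :: "'v lterm \<Rightarrow> 'v set" where
  "term_vars t = Poly_Mapping.keys (fst t)"

definition eval_term :: "('v \<Rightarrow> int) \<Rightarrow> 'v lterm \<Rightarrow> int" where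
  "eval_term \<sigma> t = (\<Sum>x\<in>term_vars t. Poly_Mapping.lookup (fst t) x * \<sigma> x) + snd t"

text \<open>
  Conjunctions are lists of literals, with \<open>[]\<close> for truth and \<open>@\<close> for conjunction. The literals of
  the input formulas (\<open>LeZero t\<close> is \<open>t \<le> 0\<close>, \<open>EqZero t\<close> is \<open>t = 0\<close>) and those of annotations
  (\<open>MEqZero t\<close> is \<open>t = 0\<close>, \<open>ModZero g t\<close> is \<open>t =\<^sub>g 0\<close>) are kept apart by their types.
\<close>

datatype 'v literal = LeZero "'v lterm" | EqZero "'v lterm"

datatype 'v mod_literal = MEqZero "'v lterm" | ModZero nat "'v lterm"

type_synonym 'v conj = "'v literal list"

type_synonym 'v mod_conj = "'v mod_literal list"

fun sat_literal :: "('v \<Rightarrow> int) \<Rightarrow> 'v literal \<Rightarrow> bool" where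
  "sat_literal \<sigma> (LeZero t) \<longleftrightarrow> eval_term \<sigma> t \<le> 0"
| "sat_literal \<sigma> (EqZero t) \<longleftrightarrow> eval_term \<sigma> t = 0"

text \<open>For \<open>g = 0\<close> divisibility by \<open>g\<close> says \<open>t = 0\<close>, as required.\<close>

fun sat_mod_literal :: "('v \<Rightarrow> int) \<Rightarrow> 'v mod_literal \<Rightarrow> bool" where
  "sat_mod_literal \<sigma> (MEqZero t) \<longleftrightarrow> eval_term \<sigma> t = 0"
| "sat_mod_literal \<sigma> (ModZero g t) \<longleftrightarrow> int g dvd eval_term \<sigma> t"

definition sat_conj :: "('v \<Rightarrow> int) \<Rightarrow> 'v conj \<Rightarrow> bool" where
  "sat_conj \<sigma> A \<longleftrightarrow> (\<forall>l\<in>set A. sat_literal \<sigma> l)"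

definition sat_mod_conj :: "('v \<Rightarrow> int) \<Rightarrow> 'v mod_conj \<Rightarrow> bool" where
  "sat_mod_conj \<sigma> E \<longleftrightarrow> (\<forall>l\<in>set E. sat_mod_literal \<sigma> l)"

fun literal_vars :: "'v literal \<Rightarrow> 'v set" where
  "literal_vars (LeZero t) = term_vars t"
| "literal_vars (EqZero t) = term_vars t"

fun mod_literal_vars :: "'v mod_literal \<Rightarrow> 'v set" where
  "mod_literal_vars (MEqZero t) = term_vars t"
| "mod_literal_vars (ModZero g t) = term_vars t"

definition conj_vars :: "'v conj \<Rightarrow> 'v set" where
  "conj_vars A = (\<Union>l\<in>set A. literal_vars l)"

definition mod_conj_vars :: "'v mod_conj \<Rightarrow> 'v set" where
  "mod_conj_vars E = (\<Union>l\<in>set E. mod_literal_vars l)"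

text \<open>
  The pair \<open>(s, E)\<close> in an annotation stands for \<open>\<langle>s \<le> 0, E\<rangle>\<close>, and \<open>Sequent A B t I\<close> for
  \<open>(A, B) \<turnstile> (t \<le> 0) [I]\<close>.
\<close>

type_synonym 'v annotation = "('v lterm \<times> 'v mod_conj) set"

datatype 'v sequent = Sequent "'v conj" "'v conj" "'v lterm" "'v annotation"

fun valid :: "'v sequent \<Rightarrow> bool" where
  "valid (Sequent A B t I) \<longleftrightarrow>
     (\<forall>\<sigma>. sat_conj \<sigma> A \<longrightarrow> (\<exists>(s, E)\<in>I. eval_term \<sigma> s \<le> 0 \<and> sat_mod_conj \<sigma> E)) \<and>
     (\<forall>(s, E)\<in>I. \<forall>\<sigma>. sat_conj \<sigma> B \<and> sat_mod_conj \<sigma> E \<longrightarrow> eval_term \<sigma> (t - s) \<le> 0) \<and>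
     (\<forall>(s, E)\<in>I. term_vars s \<subseteq> conj_vars A \<and> term_vars (t - s) \<subseteq> conj_vars B \<and>
        mod_conj_vars E \<subseteq> conj_vars A \<and> mod_conj_vars E \<subseteq> conj_vars B)"

text \<open>
  \<open>elim_nonvars B t\<close> is \<open>\<exists>(x \<notin> B). (t = 0)\<close>: the part of \<open>t\<close> over the variables of \<open>B\<close>, modulo the
  gcd of the remaining coefficients. If no variable is eliminated, the gcd is 0 and the result is
  the equation \<open>t = 0\<close> itself.
\<close>

definition elim_nonvars :: "'v conj \<Rightarrow> 'v lterm \<Rightarrow> 'v mod_literal" where
  "elim_nonvars B t =
     ModZero (nat (Gcd (Poly_Mapping.lookup (fst t) ` (term_vars t - conj_vars B))))
       (\<Sum>y\<in>term_vars t \<inter> conj_vars B. Poly_Mapping.single y (Poly_Mapping.lookup (fst t) y), snd t)"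

text \<open>\<open>rule_instance A B prems concl\<close>: some rule derives \<open>concl\<close> from exactly the premises \<open>prems\<close>.\<close>

inductive rule_instance :: "'v conj \<Rightarrow> 'v conj \<Rightarrow> 'v sequent list \<Rightarrow> 'v sequent \<Rightarrow> bool"
  for A B :: "'v conj"
where
  Hyp_A: "rule_instance A B [] (Sequent A B t {(t, [])})"
    if "LeZero t \<in> set A \<or> EqZero t \<in> set A"
| Hyp_B: "rule_instance A B [] (Sequent A B t {(const_term 0, [])})"
    if "LeZero t \<in> set B \<or> EqZero t \<in> set B"
| Comb: "rule_instance A B [Sequent A B t1 I1, Sequent A B t2 I2]
      (Sequent A B (scale_term c1 t1 + scale_term c2 t2)
        {(scale_term c1 s1 + scale_term c2 s2, E1 @ E2) | s1 E1 s2 E2.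
           (s1, E1) \<in> I1 \<and> (s2, E2) \<in> I2})"
    if "c1 > 0" "c2 > 0"
| Strengthen: "rule_instance A B [Sequent A B (p, c) {(s, [])}]
      (Sequent A B (p, c + k)
        ({(s + const_term j, [elim_nonvars B (s + const_term j)]) | j. 0 \<le> j \<and> j < k} \<union>
         {(s + const_term k, [])}))"
    if "d > 0" "\<forall>x\<in>Poly_Mapping.keys p. d dvd Poly_Mapping.lookup p x"
       "k = d * \<lceil>real_of_int c / real_of_int d\<rceil> - c"

end

theory Submission
  imports Defs
begin

text \<open>
  Only Strengthen uses integrality. If \<open>A\<close> gives \<open>s \<le> 0\<close> but \<open>s + k \<le> 0\<close> fails, then
  \<open>s + j = 0\<close> for some \<open>0 \<le> j < k\<close>, which implies its projection to the variables of \<open>B\<close>.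
  Conversely, when that projection holds, Bezout's identity changes the values of the variables
  outside \<open>B\<close> so that \<open>s + j = 0\<close>; neither \<open>B\<close> nor \<open>t - s\<close> notices the change, so
  \<open>t \<le> s = - j \<le> 0\<close>, and divisibility by \<open>d\<close> sharpens \<open>t \<le> 0\<close> to \<open>t + k \<le> 0\<close>.
\<close>

section \<open>Evaluation and occurring variables of linear terms\<close>

lemma eval_term_superset:
  assumes "finite S" "term_vars t \<subseteq> S"
  shows "eval_term \<sigma> t = (\<Sum>x\<in>S. Poly_Mapping.lookup (fst t) x * \<sigma> x) + snd t"
  unfolding eval_term_def
  using assms by (auto simp: term_vars_def in_keys_iff intro!: sum.mono_neutral_left)

lemma finite_term_vars [simp]: "finite (term_vars t)"
  by (simp add: term_vars_def)

lemma term_vars_add: "term_vars (s + t) \<subseteq> term_vars s \<union> term_vars t"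
  unfolding term_vars_def fst_add by (rule Poly_Mapping.keys_add)

lemma term_vars_scale: "term_vars (scale_term c t) \<subseteq> term_vars t"
  by (simp add: term_vars_def scale_term_def keys_cmul)

lemma term_vars_const [simp]: "term_vars (const_term c) = {}"
  by (simp add: term_vars_def const_term_def)

lemma term_vars_add_const [simp]: "term_vars (t + const_term c) = term_vars t"
  by (simp add: term_vars_def const_term_def)

lemma eval_term_const [simp]: "eval_term \<sigma> (const_term c) = c"
  by (simp add: eval_term_def) (simp add: const_term_def)

lemma eval_term_add [simp]: "eval_term \<sigma> (s + t) = eval_term \<sigma> s + eval_term \<sigma> t"
proof -
  \<comment> \<open>Cancellation can make the support of \<open>s + t\<close> smaller than the
    union. Summing all three terms over this common index set, where extra coefficients are zero,
    allows a summand-wise comparison.\<close>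
  let ?S = "term_vars s \<union> term_vars t"
  have "eval_term \<sigma> u = (\<Sum>x\<in>?S. Poly_Mapping.lookup (fst u) x * \<sigma> x) + snd u"
    if "term_vars u \<subseteq> ?S" for u
    using that by (intro eval_term_superset) auto
  from this[of s] this[of t] this[of "s + t"] show ?thesis
    by (simp add: term_vars_add lookup_add algebra_simps sum.distrib)
qed

lemma eval_term_diff [simp]: "eval_term \<sigma> (s - t) = eval_term \<sigma> s - eval_term \<sigma> t"
  using eval_term_add[of \<sigma> "s - t" t] by simp

lemma eval_term_scale [simp]: "eval_term \<sigma> (scale_term c t) = c * eval_term \<sigma> t"
proof -
  have "eval_term \<sigma> (scale_term c t) =
      (\<Sum>x\<in>term_vars t. Poly_Mapping.lookup (fst (scale_term c t)) x * \<sigma> x) + snd (scale_term c t)"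
    by (intro eval_term_superset term_vars_scale) simp
  then show ?thesis
    by (simp add: scale_term_def eval_term_def[of \<sigma> t] sum_distrib_left algebra_simps)
qed

lemma scale_term_diff: "scale_term c (s - t) = scale_term c s - scale_term c t"
  by (simp add: scale_term_def prod_eq_iff poly_mapping_eq_iff fun_eq_iff lookup_minus
      algebra_simps)

lemma eval_term_cong:
  assumes "\<And>x. x \<in> term_vars t \<Longrightarrow> \<sigma> x = \<tau> x"
  shows "eval_term \<sigma> t = eval_term \<tau> t"
  using assms by (simp add: eval_term_def)

lemma sat_conj_cong:
  assumes "\<And>x. x \<in> conj_vars B \<Longrightarrow> \<sigma> x = \<tau> x"
  shows "sat_conj \<sigma> B \<longleftrightarrow> sat_conj \<tau> B"
proof -
  have "sat_literal \<sigma> l \<longleftrightarrow> sat_literal \<tau> l" if "l \<in> set B" for l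
  proof (cases l)
    case (LeZero t)
    then have "eval_term \<sigma> t = eval_term \<tau> t"
      using that assms by (force intro: eval_term_cong simp: conj_vars_def)
    with LeZero show ?thesis by simp
  next
    case (EqZero t)
    then have "eval_term \<sigma> t = eval_term \<tau> t"
      using that assms by (force intro: eval_term_cong simp: conj_vars_def)
    with EqZero show ?thesis by simp
  qed
  then show ?thesis by (auto simp: sat_conj_def)
qed

lemma sat_mod_conj_Nil [simp]: "sat_mod_conj \<sigma> []"
  by (simp add: sat_mod_conj_def)

lemma sat_mod_conj_append [simp]:
  "sat_mod_conj \<sigma> (E @ F) \<longleftrightarrow> sat_mod_conj \<sigma> E \<and> sat_mod_conj \<sigma> F"
  by (auto simp: sat_mod_conj_def)

lemma mod_conj_vars_Nil [simp]: "mod_conj_vars [] = {}"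
  by (simp add: mod_conj_vars_def)

lemma mod_conj_vars_append [simp]: "mod_conj_vars (E @ F) = mod_conj_vars E \<union> mod_conj_vars F"
  by (simp add: mod_conj_vars_def)

section \<open>Integer combinations of a finite family and its gcd\<close>

lemma Gcd_dvd_sum_mult:
  fixes a v :: "'a \<Rightarrow> int"
  shows "Gcd (a ` X) dvd (\<Sum>x\<in>X. a x * v x)"
  by (intro dvd_sum dvd_mult2 Gcd_dvd) auto

text \<open>Induction on \<open>X\<close>: two-element Bezout is applied to the new coefficient
  \<open>a y\<close> and the gcd of the old ones. Its factor \<open>p\<close> becomes the value at
  \<open>y\<close>, and its factor \<open>q\<close> rescales the old witness.\<close>

lemma bezout_sum_Gcd:
  fixes a :: "'a \<Rightarrow> int"
  assumes "finite X"
  shows "\<exists>v. (\<Sum>x\<in>X. a x * v x) = Gcd (a ` X)"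
  using assms
proof (induction X)
  case empty
  then show ?case by simp
next
  case (insert y X)
  then obtain v where v: "(\<Sum>x\<in>X. a x * v x) = Gcd (a ` X)" by blast
  obtain p q where pq: "p * a y + q * Gcd (a ` X) = gcd (a y) (Gcd (a ` X))"
    using bezout_int by blast
  let ?v = "\<lambda>x. if x = y then p else q * v x"
  have "(\<Sum>x\<in>X. a x * ?v x) = (\<Sum>x\<in>X. q * (a x * v x))"
    using insert.hyps by (intro sum.cong) (auto simp: algebra_simps)
  also have "\<dots> = q * Gcd (a ` X)"
    by (simp add: v flip: sum_distrib_left)
  finally have "(\<Sum>x\<in>insert y X. a x * ?v x) = Gcd (a ` insert y X)"
    using insert.hyps pq by (simp add: algebra_simps)
  then show ?case by (rule exI[of _ ?v])
qed

text \<open>A Bezout witness for the gcd, scaled by the quotient of \<open>e\<close> by the gcd,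
  solves the equation. For empty \<open>X\<close> the gcd is 0 and divisibility means
  \<open>e = 0\<close>, which is the case where no variable is eliminated.\<close>

lemma ex_sum_mult_eq_iff_Gcd_dvd:
  fixes a :: "'a \<Rightarrow> int"
  assumes "finite X"
  shows "(\<exists>v. (\<Sum>x\<in>X. a x * v x) = e) \<longleftrightarrow> Gcd (a ` X) dvd e"
proof
  assume "\<exists>v. (\<Sum>x\<in>X. a x * v x) = e"
  then show "Gcd (a ` X) dvd e" using Gcd_dvd_sum_mult by blast
next
  assume "Gcd (a ` X) dvd e"
  then obtain m where m: "e = Gcd (a ` X) * m" ..
  obtain v where "(\<Sum>x\<in>X. a x * v x) = Gcd (a ` X)"
    using bezout_sum_Gcd[OF assms] by blast
  with m have "(\<Sum>x\<in>X. a x * (v x * m)) = e"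
    by (metis (no_types, lifting) mult.assoc sum.cong sum_distrib_right)
  then show "\<exists>v. (\<Sum>x\<in>X. a x * v x) = e" by (intro exI)
qed

section \<open>Projecting an equation to the variables of \<open>B\<close>\<close>

lemma lookup_sum_single:
  assumes "finite S"
  shows "Poly_Mapping.lookup (\<Sum>y\<in>S. Poly_Mapping.single y (f y)) x = (if x \<in> S then f x else 0)"
  using assms by (simp add: lookup_sum lookup_single when_def)

text \<open>The retained coefficients are nonzero, so no retained variable is lost. This yields the
  variable condition on annotations in Strengthen, where the variables of \<open>t\<close> occur in
  \<open>A\<close>.\<close>

lemma mod_literal_vars_elim_nonvars:
  "mod_literal_vars (elim_nonvars B t) = term_vars t \<inter> conj_vars B"
  by (auto simp: elim_nonvars_def term_vars_def in_keys_iff lookup_sum_single split: if_splits)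

text \<open>Correctness of the quantifier elimination. With the values on \<open>B\<close> fixed,
  only the eliminated part of \<open>t\<close> can vary, and it takes exactly the multiples of the
  gcd of its coefficients.\<close>

lemma sat_elim_nonvars_iff:
  "sat_mod_literal \<sigma> (elim_nonvars B t) \<longleftrightarrow>
     (\<exists>\<tau>. (\<forall>x\<in>conj_vars B. \<tau> x = \<sigma> x) \<and> eval_term \<tau> t = 0)"
proof -
  let ?a = "Poly_Mapping.lookup (fst t)"
  let ?X = "term_vars t - conj_vars B" and ?Y = "term_vars t \<inter> conj_vars B"
  \<comment> \<open>The contribution of the retained part and the constant: it is the same for every
    assignment agreeing with \<sigma> on \<open>B\<close>, so \<open>t = 0\<close> asks the
    eliminated part to equal \<open>- r\<close>.\<close>
  define r where "r = (\<Sum>y\<in>?Y. ?a y * \<sigma> y) + snd t"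
  have "eval_term \<sigma> (\<Sum>y\<in>?Y. Poly_Mapping.single y (?a y), snd t) = r"
    by (subst eval_term_superset[where S = ?Y])
      (auto simp: r_def term_vars_def in_keys_iff lookup_sum_single split: if_splits)
  then have "sat_mod_literal \<sigma> (elim_nonvars B t) \<longleftrightarrow> Gcd (?a ` ?X) dvd - r"
    by (simp add: elim_nonvars_def)
  also have "\<dots> \<longleftrightarrow> (\<exists>v. (\<Sum>x\<in>?X. ?a x * v x) = - r)"
    by (rule ex_sum_mult_eq_iff_Gcd_dvd[symmetric]) simp
  also have "\<dots> \<longleftrightarrow> (\<exists>\<tau>. (\<forall>x\<in>conj_vars B. \<tau> x = \<sigma> x) \<and> eval_term \<tau> t = 0)"
  proof -
    have eval: "eval_term \<tau> t = (\<Sum>x\<in>?X. ?a x * \<tau> x) + r"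
      if "\<forall>x\<in>conj_vars B. \<tau> x = \<sigma> x" for \<tau>
    proof -
      have "(\<Sum>y\<in>?Y. ?a y * \<tau> y) = (\<Sum>y\<in>?Y. ?a y * \<sigma> y)"
        using that by (intro sum.cong) auto
      then show ?thesis
        using sum.Int_Diff[of "term_vars t" "\<lambda>x. ?a x * \<tau> x" "conj_vars B"]
        by (simp add: eval_term_def r_def)
    qed
    show ?thesis
    proof
      assume "\<exists>v. (\<Sum>x\<in>?X. ?a x * v x) = - r"
      then obtain v where v: "(\<Sum>x\<in>?X. ?a x * v x) = - r" ..
      define \<tau> where "\<tau> x = (if x \<in> conj_vars B then \<sigma> x else v x)" for x
      have "(\<Sum>x\<in>?X. ?a x * \<tau> x) = (\<Sum>x\<in>?X. ?a x * v x)"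
        by (intro sum.cong) (auto simp: \<tau>_def)
      then show "\<exists>\<tau>. (\<forall>x\<in>conj_vars B. \<tau> x = \<sigma> x) \<and> eval_term \<tau> t = 0"
        using eval[of \<tau>] v by (intro exI[of _ \<tau>]) (simp add: \<tau>_def)
    next
      assume "\<exists>\<tau>. (\<forall>x\<in>conj_vars B. \<tau> x = \<sigma> x) \<and> eval_term \<tau> t = 0"
      then show "\<exists>v. (\<Sum>x\<in>?X. ?a x * v x) = - r"
        using eval by (metis eq_neg_iff_add_eq_0)
    qed
  qed
  finally show ?thesis .
qed

section \<open>Rounding the constant up to a multiple of \<open>d\<close>\<close>

lemma le_ceiling_divide_mult:
  fixes c d :: int
  assumes "d > 0"
  shows "c \<le> d * \<lceil>real_of_int c / real_of_int d\<rceil>"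
proof -
  have "real_of_int c / real_of_int d \<le> real_of_int \<lceil>real_of_int c / real_of_int d\<rceil>"
    by (rule le_of_int_ceiling)
  then have "real_of_int c \<le> real_of_int (d * \<lceil>real_of_int c / real_of_int d\<rceil>)"
    using assms by (simp add: pos_divide_le_eq mult.commute del: le_of_int_ceiling)
  then show ?thesis by (simp only: of_int_le_iff)
qed

text \<open>Writing \<open>e = d * m\<close>, the bound \<open>e + c \<le> 0\<close> says that
  \<open>c / d\<close> is at most the integer \<open>- m\<close>. Hence so is its ceiling, and
  multiplying by \<open>d\<close> gives the claim.\<close>

lemma dvd_add_nonpos_strengthen:
  fixes c d e :: int
  assumes "d > 0" "d dvd e" "e + c \<le> 0"
  shows "e + d * \<lceil>real_of_int c / real_of_int d\<rceil> \<le> 0"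
proof -
  obtain m where m: "e = d * m" using assms(2) ..
  have "real_of_int c \<le> real_of_int (- (d * m))"
    using assms(3) m by linarith
  then have "\<lceil>real_of_int c / real_of_int d\<rceil> \<le> - m"
    using assms(1) by (simp add: ceiling_le_iff field_simps)
  then have "d * \<lceil>real_of_int c / real_of_int d\<rceil> \<le> d * - m"
    using assms(1) by (intro mult_left_mono) auto
  then show ?thesis by (simp add: m)
qed

section \<open>Validity preservation, rule by rule\<close>

lemma validI:
  assumes "\<And>\<sigma>. sat_conj \<sigma> A \<Longrightarrow> \<exists>(s, E)\<in>I. eval_term \<sigma> s \<le> 0 \<and> sat_mod_conj \<sigma> E"
    and "\<And>s E. (s, E) \<in> I \<Longrightarrow>
      (\<forall>\<sigma>. sat_conj \<sigma> B \<and> sat_mod_conj \<sigma> E \<longrightarrow> eval_term \<sigma> (t - s) \<le> 0) \<and>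
      term_vars s \<subseteq> conj_vars A \<and> term_vars (t - s) \<subseteq> conj_vars B \<and>
      mod_conj_vars E \<subseteq> conj_vars A \<and> mod_conj_vars E \<subseteq> conj_vars B"
  shows "valid (Sequent A B t I)"
  using assms unfolding valid.simps by blast

lemma valid_Hyp_A:
  assumes "LeZero t \<in> set A \<or> EqZero t \<in> set A"
  shows "valid (Sequent A B t {(t, [])})"
  using assms by (force simp: sat_conj_def conj_vars_def term_vars_def)

lemma valid_Hyp_B:
  assumes "LeZero t \<in> set B \<or> EqZero t \<in> set B"
  shows "valid (Sequent A B t {(const_term 0, [])})"
proof -
  have "term_vars (t - const_term 0) = term_vars t"
    by (simp add: const_term_def term_vars_def)
  then show ?thesis
    using assms by (auto simp: sat_conj_def conj_vars_def)
qed

text \<open>Every assignment satisfying \<open>A\<close> selects a true disjunct from each premise,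
  and the pair selects one of the conclusion. The conditions on \<open>B\<close> carry over because
  positive combinations preserve upper bounds by zero.\<close>

lemma valid_Comb:
  assumes "valid (Sequent A B t1 I1)" "valid (Sequent A B t2 I2)" "c1 > 0" "c2 > 0"
  shows "valid (Sequent A B (scale_term c1 t1 + scale_term c2 t2)
    {(scale_term c1 s1 + scale_term c2 s2, E1 @ E2) | s1 E1 s2 E2.
       (s1, E1) \<in> I1 \<and> (s2, E2) \<in> I2})" (is "valid (Sequent A B ?t ?I)")
proof -
  have nonpos: "c1 * a + c2 * b \<le> 0" if "a \<le> 0" "b \<le> 0" for a b
    using that assms(3,4) by (simp add: add_nonpos_nonpos mult_nonneg_nonpos)
  have vars: "term_vars (scale_term c1 u + scale_term c2 v) \<subseteq> V"
    if "term_vars u \<subseteq> V" "term_vars v \<subseteq> V" for u v :: "'a lterm" and V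
    using that term_vars_add[of "scale_term c1 u" "scale_term c2 v"]
      term_vars_scale[of c1 u] term_vars_scale[of c2 v] by blast
  have "\<exists>(s, E)\<in>?I. eval_term \<sigma> s \<le> 0 \<and> sat_mod_conj \<sigma> E" if A: "sat_conj \<sigma> A" for \<sigma>
  proof -
    from A assms(1) obtain s1 E1
      where 1: "(s1, E1) \<in> I1" "eval_term \<sigma> s1 \<le> 0" "sat_mod_conj \<sigma> E1"
      unfolding valid.simps by blast
    from A assms(2) obtain s2 E2
      where 2: "(s2, E2) \<in> I2" "eval_term \<sigma> s2 \<le> 0" "sat_mod_conj \<sigma> E2"
      unfolding valid.simps by blast
    have "(scale_term c1 s1 + scale_term c2 s2, E1 @ E2) \<in> ?I" using 1 2 by blast
    moreover have "eval_term \<sigma> (scale_term c1 s1 + scale_term c2 s2) \<le> 0"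
      using 1 2 nonpos by simp
    moreover have "sat_mod_conj \<sigma> (E1 @ E2)" using 1 2 by simp
    ultimately show ?thesis by blast
  qed
  moreover have
    "(\<forall>\<sigma>. sat_conj \<sigma> B \<and> sat_mod_conj \<sigma> E \<longrightarrow> eval_term \<sigma> (?t - s) \<le> 0) \<and>
     term_vars s \<subseteq> conj_vars A \<and> term_vars (?t - s) \<subseteq> conj_vars B \<and>
     mod_conj_vars E \<subseteq> conj_vars A \<and> mod_conj_vars E \<subseteq> conj_vars B" if I: "(s, E) \<in> ?I" for s E
  proof -
    from I obtain s1 E1 s2 E2 where s: "s = scale_term c1 s1 + scale_term c2 s2"
      and E: "E = E1 @ E2" and mem: "(s1, E1) \<in> I1" "(s2, E2) \<in> I2" by auto
    have 1: "\<And>\<sigma>. sat_conj \<sigma> B \<Longrightarrow> sat_mod_conj \<sigma> E1 \<Longrightarrow> eval_term \<sigma> (t1 - s1) \<le> 0"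
      "term_vars s1 \<subseteq> conj_vars A" "term_vars (t1 - s1) \<subseteq> conj_vars B"
      "mod_conj_vars E1 \<subseteq> conj_vars A" "mod_conj_vars E1 \<subseteq> conj_vars B"
      using assms(1) mem(1) unfolding valid.simps by blast+
    have 2: "\<And>\<sigma>. sat_conj \<sigma> B \<Longrightarrow> sat_mod_conj \<sigma> E2 \<Longrightarrow> eval_term \<sigma> (t2 - s2) \<le> 0"
      "term_vars s2 \<subseteq> conj_vars A" "term_vars (t2 - s2) \<subseteq> conj_vars B"
      "mod_conj_vars E2 \<subseteq> conj_vars A" "mod_conj_vars E2 \<subseteq> conj_vars B"
      using assms(2) mem(2) unfolding valid.simps by blast+
    \<comment> \<open>Subtraction commutes with the combination, so both the bound and the variable
      condition on \<open>?t - s\<close> reduce to those on \<open>t1 - s1\<close> and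
      \<open>t2 - s2\<close>.\<close>
    have diff: "?t - s = scale_term c1 (t1 - s1) + scale_term c2 (t2 - s2)"
      by (simp add: s scale_term_diff)
    have "eval_term \<sigma> (?t - s) \<le> 0" if "sat_conj \<sigma> B" "sat_mod_conj \<sigma> E" for \<sigma>
      unfolding diff eval_term_add eval_term_scale
      using that 1(1) 2(1) E by (intro nonpos) simp_all
    moreover have "term_vars s \<subseteq> conj_vars A"
      unfolding s using 1 2 by (intro vars)
    moreover have "term_vars (?t - s) \<subseteq> conj_vars B"
      unfolding diff using 1 2 by (intro vars)
    ultimately show ?thesis using 1 2 by (simp add: E)
  qed
  ultimately show ?thesis by (rule validI)
qed

lemma valid_Strengthen:
  assumes prem: "valid (Sequent A B (p, c) {(s, [])})"
    and d: "d > 0" "\<forall>x\<in>Poly_Mapping.keys p. d dvd Poly_Mapping.lookup p x"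
    and k: "k = d * \<lceil>real_of_int c / real_of_int d\<rceil> - c"
  shows "valid (Sequent A B (p, c + k)
    ({(s + const_term j, [elim_nonvars B (s + const_term j)]) | j. 0 \<le> j \<and> j < k} \<union>
     {(s + const_term k, [])}))" (is "valid (Sequent A B ?t ?I)")
proof -
  have A: "eval_term \<sigma> s \<le> 0" if "sat_conj \<sigma> A" for \<sigma>
    using prem that by auto
  have B: "eval_term \<sigma> ((p, c) - s) \<le> 0" if "sat_conj \<sigma> B" for \<sigma>
    using prem that by auto
  have vars: "term_vars s \<subseteq> conj_vars A" "term_vars ((p, c) - s) \<subseteq> conj_vars B"
    using prem by auto
  have t: "?t = (p, c) + const_term k" by (simp add: const_term_def)
  have "k \<ge> 0" using le_ceiling_divide_mult[OF d(1)] k by simp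
  \<comment> \<open>Since \<open>d\<close> divides every coefficient of \<open>p\<close>, this holds
    under all assignments; below it is applied to a modified one rather than to the given
    one.\<close>
  have round_up: "eval_term \<sigma> (p, c) + k \<le> 0" if "eval_term \<sigma> (p, c) \<le> 0" for \<sigma>
  proof -
    define e where "e = (\<Sum>x\<in>Poly_Mapping.keys p. Poly_Mapping.lookup p x * \<sigma> x)"
    have "eval_term \<sigma> (p, c) = e + c" by (simp add: eval_term_def term_vars_def e_def)
    moreover have "d dvd e" unfolding e_def using d(2) by (intro dvd_sum dvd_mult2) auto
    ultimately show ?thesis
      using dvd_add_nonpos_strengthen[OF d(1), of e c] that by (simp add: k)
  qed
  have "\<exists>(u, E)\<in>?I. eval_term \<sigma> u \<le> 0 \<and> sat_mod_conj \<sigma> E" if "sat_conj \<sigma> A" for \<sigma>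
  proof (cases "eval_term \<sigma> s + k \<le> 0")
    case True
    then show ?thesis by auto
  next
    case False
    \<comment> \<open>The slack in \<open>s \<le> 0\<close>: the premise makes it nonnegative, and
      failure of \<open>s + k \<le> 0\<close> is exactly \<open>j < k\<close>.\<close>
    define j where "j = - eval_term \<sigma> s"
    have j: "0 \<le> j" "j < k" and zero: "eval_term \<sigma> (s + const_term j) = 0"
      using A[OF that] False by (auto simp: j_def)
    have "sat_mod_literal \<sigma> (elim_nonvars B (s + const_term j))"
      \<comment> \<open>The assignment \<sigma> itself witnesses the projected equation.\<close>
      unfolding sat_elim_nonvars_iff using zero by blast
    then have "sat_mod_conj \<sigma> [elim_nonvars B (s + const_term j)]"
      by (simp add: sat_mod_conj_def)
    moreover have "(s + const_term j, [elim_nonvars B (s + const_term j)]) \<in> ?I"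
      using j by blast
    moreover have "eval_term \<sigma> (s + const_term j) \<le> 0" using zero by simp
    ultimately show ?thesis by blast
  qed
  moreover have
    "(\<forall>\<sigma>. sat_conj \<sigma> B \<and> sat_mod_conj \<sigma> E \<longrightarrow> eval_term \<sigma> (?t - u) \<le> 0) \<and>
     term_vars u \<subseteq> conj_vars A \<and> term_vars (?t - u) \<subseteq> conj_vars B \<and>
     mod_conj_vars E \<subseteq> conj_vars A \<and> mod_conj_vars E \<subseteq> conj_vars B" if I: "(u, E) \<in> ?I" for u E
  proof -
    from I consider
        (strict) j where "0 \<le> j" "j < k" "u = s + const_term j" "E = [elim_nonvars B u]"
      | (last) "u = s + const_term k" "E = []" by auto
    then show ?thesis
    proof cases
      case strict
      have diff: "?t - u = ((p, c) - s) + const_term (k - j)"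
        unfolding t strict(3) by (simp add: const_term_def prod_eq_iff)
      have "eval_term \<sigma> (?t - u) \<le> 0" if sat: "sat_conj \<sigma> B" "sat_mod_conj \<sigma> E" for \<sigma>
      proof -
        have "sat_mod_literal \<sigma> (elim_nonvars B u)"
          using sat(2) strict(4) by (simp add: sat_mod_conj_def)
        \<comment> \<open>The assignment \<sigma> need not satisfy \<open>s = - j\<close>; \<tau>
          does, and differs from \<sigma> only outside \<open>B\<close>.\<close>
        then obtain \<tau> where \<tau>: "\<And>x. x \<in> conj_vars B \<Longrightarrow> \<tau> x = \<sigma> x" and zero: "eval_term \<tau> u = 0"
          unfolding sat_elim_nonvars_iff by blast
        have s: "eval_term \<tau> s = - j" using zero strict(3) by simp
        have "sat_conj \<tau> B" using sat(1) sat_conj_cong[of B \<tau> \<sigma>] \<tau> by simp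
        from B[OF this] s strict(1) have "eval_term \<tau> (p, c) \<le> 0" by simp
        with round_up have "eval_term \<tau> (p, c) + k \<le> 0" .
        \<comment> \<open>The rounded bound holds at \<tau>, but the goal concerns \<sigma>. The
          difference transfers the bound since its variables lie in \<open>B\<close>. At \<tau> it
          equals \<open>(p, c) + j\<close>, so adding \<open>k - j\<close> leaves
          \<open>(p, c) + k\<close>.\<close>
        moreover have "eval_term \<sigma> ((p, c) - s) = eval_term \<tau> ((p, c) - s)"
          using vars(2) \<tau> by (intro eval_term_cong) fastforce
        ultimately show ?thesis
          unfolding diff eval_term_add eval_term_const using s by simp
      qed
      moreover have "term_vars u = term_vars s" "term_vars (?t - u) = term_vars ((p, c) - s)"
        unfolding diff unfolding strict(3) by simp_all
      ultimately show ?thesis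
        using vars strict(4) by (auto simp: mod_conj_vars_def mod_literal_vars_elim_nonvars)
    next
      case last
      \<comment> \<open>Both terms are shifted by \<open>k\<close>, so the premise's bound applies
        without rounding.\<close>
      have diff: "?t - u = (p, c) - s" unfolding t last(1) by simp
      show ?thesis unfolding diff using B vars last by simp
    qed
  qed
  ultimately show ?thesis by (rule validI)
qed

theorem theorem3p5:
  fixes A B :: "'v conj" and prems :: "'v sequent list" and concl :: "'v sequent"
  assumes "rule_instance A B prems concl"
    and "\<forall>S\<in>set prems. valid S"
  shows "valid concl"
  using assms
proof (cases rule: rule_instance.cases)
  case (Hyp_A t)
  then show ?thesis using valid_Hyp_A by blast
next
  case (Hyp_B t)
  then show ?thesis using valid_Hyp_B by blast
next
  case (Comb c1 c2 t1 I1 t2 I2)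
  then show ?thesis using assms(2) valid_Comb[of A B t1 I1 t2 I2 c1 c2] by (simp del: valid.simps)
next
  case (Strengthen d p k c s)
  then show ?thesis
    using assms(2) valid_Strengthen[of A B p c s d k] by (simp del: valid.simps)
qed

end
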